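(* Let $n\ge0$ be an integer, $\sigma\ge n+1$ a real number, and let $f(z)=z+\sum_{k\ge2}a_kz^k$ belong to $S_n^\sigma$. Then $$|a_k|\le\frac{\sigma!}{(\sigma+k-1)!}\,\frac{(\sigma+k-1-n)!}{(\sigma-n)!}\,k,\qquad k\ge2.$$ These inequalities are sharp: the function $$k_n^\sigma(z)=z+\sum_{k=2}^\infty\left\{\frac{\sigma!}{(\sigma+k-1)!}\,\frac{(\sigma+k-1-n)!}{(\sigma-n)!}\right\}k\,z^k$$ belongs to $S_n^\sigma$ and attains equality for every $k\ge2$.
   Context: For real $x>-1$, $x!$ means $\Gamma(x+1)$; thus $\frac{\sigma!}{(\sigma+k-1)!}\frac{(\sigma+k-1-n)!}{(\sigma-n)!}=\prod_{j=0}^{n-1}\frac{\sigma-j}{\sigma+k-1-j}$. Let $E=\{z\in\mathbb{C}:|z|<1\}$ and let $A$ be the class of analytic functions on $E$ of the form $f(z)=z+\sum_{k\ge2}a_kz^k$. For an integer $n\ge0$ and a real number $\sigma$ with $\sigma-(n-1)>0$, the operator $L_n^\sigma:A\to A$ is defined by $$L_n^\sigma f(z)=z+\sum_{k=2}^\infty\left\{\prod_{j=0}^{n-1}\frac{\sigma+k-1-j}{\sigma-j}\right\}a_kz^k$$ (the empty product is $1$, so $L_0^\sigma f=f$). For an integer $n\ge0$ and real $\sigma\ge n+1$, a function $f\in A$ belongs to the class $S_n^\sigma$ if and only if $$\mathrm{Re}\,\frac{L_{n+1}^\sigma f(z)}{L_n^\sigma f(z)}>\frac{\sigma-(n+1)}{\sigma-n},\qquad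 z\in E,$$ where the quotient at $z=0$ is understood as its limit $1$. *)

theory Defs
  imports "HOL-Complex_Analysis.Complex_Analysis"
begin

definition rfact :: "real \<Rightarrow> real" where
  "rfact x = Gamma (x + 1)"

abbreviation taylor_coeff :: "(complex \<Rightarrow> complex) \<Rightarrow> nat \<Rightarrow> complex" where
  "taylor_coeff f k \<equiv> fps_nth (fps_expansion f 0) k"

(* Functions are total in HOL: only the values on the unit disk matter, here and below. *)
definition class_A :: "(complex \<Rightarrow> complex) set" where
  "class_A = {f. f analytic_on ball 0 1 \<and> taylor_coeff f 0 = 0 \<and> taylor_coeff f 1 = 1}"

lemma normalized_power_series:
  assumes "\<And>z. z \<in> ball 0 1 \<Longrightarrow> (\<lambda>k. a (k + 2) * z ^ (k + 2)) sums (f z - z)"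
  shows "f analytic_on ball 0 1"
    and "taylor_coeff f k = (if k = 0 then 0 else if k = 1 then 1 else a k)"
proof -
  define b where "b k = (if k = 0 then 0 else if k = 1 then 1 else a k)" for k
  have sums: "(\<lambda>k. b k * (z - 0) ^ k) sums f z" if "z \<in> ball 0 1" for z
  proof -
    have "(\<lambda>k. b (k + 2) * z ^ (k + 2)) sums (f z - (\<Sum>k<2. b k * z ^ k))"
      using assms[OF that] by (simp add: b_def numeral_2_eq_2)
    thus ?thesis by (subst (asm) sums_iff_shift) simp
  qed
  have hol: "f holomorphic_on ball 0 1"
    using power_series_holomorphic[OF sums] by simp
  thus "f analytic_on ball 0 1" by (simp add: analytic_on_open)
  have "eventually (\<lambda>z. (\<lambda>k. fps_nth (Abs_fps b) k * z ^ k) sums f z) (nhds 0)"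
    using eventually_nhds_in_open[of "ball 0 1" "0 :: complex"] sums
    by (auto elim!: eventually_mono)
  hence "f has_fps_expansion Abs_fps b" by (rule has_fps_expansionI)
  hence "b k = (deriv ^^ k) f 0 / fact k" using fps_nth_fps_expansion by fastforce
  thus "taylor_coeff f k = (if k = 0 then 0 else if k = 1 then 1 else a k)"
    by (simp add: b_def fps_expansion_def)
qed

lemma class_A_iff_power_series:
  "f \<in> class_A \<longleftrightarrow>
     (\<exists>a. \<forall>z\<in>ball 0 1. (\<lambda>k. a (k + 2) * z ^ (k + 2)) sums (f z - z))"
proof
  assume f: "f \<in> class_A"
  have "(\<lambda>k. taylor_coeff f (k + 2) * z ^ (k + 2)) sums (f z - z)" if z: "z \<in> ball 0 1" for z
  proof -
    have "(\<lambda>k. taylor_coeff f k * z ^ k) sums f z"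
      using f z holomorphic_power_series[of f 0 1 z]
      by (simp add: class_A_def analytic_on_open fps_expansion_def)
    hence "(\<lambda>k. taylor_coeff f (k + 2) * z ^ (k + 2)) sums
        (f z - (\<Sum>k<2. taylor_coeff f k * z ^ k))"
      by (subst sums_iff_shift) simp
    moreover have "(\<Sum>k<2. taylor_coeff f k * z ^ k) = z"
      using f by (simp add: class_A_def numeral_2_eq_2)
    ultimately show ?thesis by simp
  qed
  thus "\<exists>a. \<forall>z\<in>ball 0 1. (\<lambda>k. a (k + 2) * z ^ (k + 2)) sums (f z - z)" by blast
next
  assume "\<exists>a. \<forall>z\<in>ball 0 1. (\<lambda>k. a (k + 2) * z ^ (k + 2)) sums (f z - z)"
  thus "f \<in> class_A"
    using normalized_power_series[of _ f] by (fastforce simp: class_A_def)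
qed

definition L_op :: "nat \<Rightarrow> real \<Rightarrow> (complex \<Rightarrow> complex) \<Rightarrow> complex \<Rightarrow> complex" where
  "L_op n \<sigma> f z = z + (\<Sum>i. let k = i + 2 in
     of_real (\<Prod>j<n. (\<sigma> + real k - 1 - real j) / (\<sigma> - real j)) * taylor_coeff f k * z ^ k)"

(* A zero of L_op n \<sigma> f in the punctured disk gives the HOL quotient 0 there, which violates
   the strict inequality when \<sigma> \<ge> n + 1; so membership entails that the quotient is
   defined on the whole disk. *)
definition class_S :: "nat \<Rightarrow> real \<Rightarrow> (complex \<Rightarrow> complex) set" where
  "class_S n \<sigma> = {f \<in> class_A. \<forall>z\<in>ball 0 1.
     Re (if z = 0 then 1 else L_op (n + 1) \<sigma> f z / L_op n \<sigma> f z)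
       > (\<sigma> - (real n + 1)) / (\<sigma> - real n)}"

definition coeff_factor :: "nat \<Rightarrow> real \<Rightarrow> nat \<Rightarrow> real" where
  "coeff_factor n \<sigma> k =
     rfact \<sigma> / rfact (\<sigma> + real k - 1) * (rfact (\<sigma> + real k - 1 - real n) / rfact (\<sigma> - real n))"

lemma coeff_factor_eq_prod:
  assumes "\<sigma> \<ge> real n" "k \<ge> 2"
  shows "coeff_factor n \<sigma> k = (\<Prod>j<n. (\<sigma> - real j) / (\<sigma> + real k - 1 - real j))"
  using assms(1)
proof (induction n)
  case 0
  have "Gamma (\<sigma> + 1) \<noteq> 0" "Gamma (\<sigma> + real k) \<noteq> 0"
    using 0 assms(2) by (simp_all add: less_imp_neq[symmetric])
  thus ?case by (simp add: coeff_factor_def rfact_def)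
next
  case (Suc n)
  define x y where "x = \<sigma> - real n" and "y = \<sigma> + real k - 1 - real n"
  have pos: "x > 0" "y > 0" using Suc.prems assms(2) by (auto simp: x_def y_def)
  have "Gamma (x + 1) = x * Gamma x" "Gamma (y + 1) = y * Gamma y"
    using pos by (auto intro!: Gamma_plus1 simp: nonpos_Ints_def)
  moreover have "Gamma x > 0" "Gamma y > 0" using pos by (auto intro: Gamma_real_pos)
  moreover have "coeff_factor n \<sigma> k =
      rfact \<sigma> / rfact (\<sigma> + real k - 1) * (Gamma (y + 1) / Gamma (x + 1))"
    by (simp add: coeff_factor_def rfact_def x_def y_def)
  moreover have "coeff_factor (Suc n) \<sigma> k =
      rfact \<sigma> / rfact (\<sigma> + real k - 1) * (Gamma y / Gamma x)"
    by (simp add: coeff_factor_def rfact_def x_def y_def algebra_simps)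
  ultimately have "coeff_factor (Suc n) \<sigma> k = coeff_factor n \<sigma> k * (x / y)"
    using pos by simp
  thus ?case using Suc by (simp add: x_def y_def)
qed

definition extremal_fun :: "nat \<Rightarrow> real \<Rightarrow> complex \<Rightarrow> complex" where
  "extremal_fun n \<sigma> z =
     z + (\<Sum>i. let k = i + 2 in of_real (coeff_factor n \<sigma> k) * of_nat k * z ^ k)"

end

theory Submission
  imports Defs
begin

text \<open>
  Write \<open>F = L_op n \<sigma> f\<close>. Passing from \<open>L_op n\<close> to \<open>L_op (n + 1)\<close> multiplies the coefficient of
  \<open>z ^ k\<close> by \<open>(\<sigma> - n + k - 1) / (\<sigma> - n)\<close>, which is affine in \<open>k\<close>; hence
  \<open>(\<sigma> - n) L_op (n + 1) \<sigma> f = (\<sigma> - n - 1) F + z F'\<close> (\<open>L_op_Suc\<close>). Dividing by \<open>F\<close> turns the defining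
  inequality of \<open>class_S n \<sigma>\<close> into \<open>Re (z F' / F) > 0\<close>, so that \<open>f\<close> belongs to the class exactly if
  \<open>F\<close> is a starlike function (\<open>class_S_iff_starlike\<close>).

  The theorem is thereby Nevanlinna's theorem that the coefficients \<open>b k\<close> of a starlike function satisfy
  \<open>cmod (b k) \<le> k\<close>, transported through \<open>L_op n \<sigma>\<close>, whose multipliers are the reciprocals of
  \<open>coeff_factor n \<sigma> k\<close>. To prove it, expand \<open>p = z F' / F\<close>, a function of positive real part with
  \<open>p 0 = 1\<close>. By a bound of Caratheodory its coefficients are at most \<open>2\<close> in modulus
  (\<open>caratheodory_coeff_bound\<close>). Comparing coefficients in \<open>p F = z F'\<close> expresses \<open>(k - 1) b k\<close> through
  the earlier coefficients, and induction gives
  \<open>(k - 1) cmod (b k) \<le> 2 (1 + \<dots> + (k - 1)) = (k - 1) k\<close> (\<open>starlike_coeff_bound\<close>).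

  For \<open>extremal_fun n \<sigma>\<close> the multipliers cancel the factors, and \<open>F\<close> is the Koebe function
  \<open>z / (1 - z)\<^sup>2\<close>, for which \<open>z F' / F = (1 + z) / (1 - z)\<close> has positive real part.
\<close>

section \<open>Functions with nonnegative real part\<close>

text \<open>
  On the circle of radius \<open>r < 1\<close>, Cauchy's formula gives \<open>c r ^ k\<close> as the mean of
  \<open>p e\<^sup>-\<^sup>i\<^sup>k\<^sup>t\<close>, where \<open>c\<close> is the coefficient of order \<open>k\<close>, while the mean of
  \<open>p e\<^sup>i\<^sup>k\<^sup>t\<close> vanishes by Cauchy's theorem. Adding the conjugate of the second to the first
  replaces \<open>p\<close> by \<open>2 Re p\<close>, which is its own modulus and has mean \<open>2 Re (p 0)\<close>.
  Finally \<open>r\<close> tends to \<open>1\<close>.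
\<close>

lemma caratheodory_coeff_bound:
  assumes hol: "p holomorphic_on ball 0 1"
    and Re: "\<And>z. z \<in> ball 0 1 \<Longrightarrow> Re (p z) \<ge> 0"
    and k: "k > 0"
  shows "cmod (taylor_coeff p k) \<le> 2 * Re (p 0)"
proof -
  have bound: "cmod (taylor_coeff p k) * r ^ k \<le> 2 * Re (p 0)" if r: "0 < r" "r < 1" for r :: real
  proof -
    define e where "e t = exp (2 * of_real pi * \<i> * of_real t)" for t :: real
    have e_norm: "cmod (e t) = 1" for t
      by (simp add: e_def norm_exp_eq_Re)
    have e_cnj: "cnj (e t) = inverse (e t)" for t
      by (simp add: e_def exp_cnj flip: exp_minus)
    have [simp]: "e t \<noteq> 0" for t by (simp add: e_def)
    have circle: "circlepath 0 r t = of_real r * e t" for t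
      by (simp add: circlepath e_def)
    have circle': "vector_derivative (circlepath 0 r) (at t) = 2 * pi * \<i> * r * e t" for t
      by (simp add: vector_derivative_circlepath e_def)
    have A: "((\<lambda>t. p (of_real r * e t) * cnj (e t) ^ m)
        has_integral (taylor_coeff p m * of_real r ^ m)) {0..1}" for m
    proof -
      have "((\<lambda>u. p u / (u - 0) ^ Suc m) has_contour_integral
          (2 * pi * \<i>) / fact m * (deriv ^^ m) p 0) (circlepath 0 r)"
      proof (rule Cauchy_has_contour_integral_higher_derivative_circlepath)
        have "p holomorphic_on cball 0 r"
          by (rule holomorphic_on_subset[OF hol]) (use r in auto)
        thus "continuous_on (cball 0 r) p" "p holomorphic_on ball 0 r"
          by (auto intro: holomorphic_on_imp_continuous_on holomorphic_on_subset)
      qed (use r in auto)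
      hence "((\<lambda>t. p (of_real r * e t) / (of_real r * e t) ^ Suc m * (2 * pi * \<i> * r * e t))
          has_integral (2 * pi * \<i>) / fact m * (deriv ^^ m) p 0) {0..1}"
        by (simp add: has_contour_integral circle circle')
      \<comment> \<open>Since \<open>cnj (e t)\<close> is the inverse of \<open>e t\<close>, scaling makes this the \<open>m\<close>-th Fourier
        coefficient.\<close>
      hence "((\<lambda>t. of_real r ^ m / (2 * pi * \<i>) *
            (p (of_real r * e t) / (of_real r * e t) ^ Suc m * (2 * pi * \<i> * r * e t)))
          has_integral of_real r ^ m / (2 * pi * \<i>) * ((2 * pi * \<i>) / fact m * (deriv ^^ m) p 0)) {0..1}"
        by (rule has_integral_mult_right)
      thus ?thesis
        using r by (simp add: fps_expansion_def e_cnj field_simps)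
    qed
    have B: "((\<lambda>t. p (of_real r * e t) * e t ^ k) has_integral 0) {0..1}"
    proof -
      have "((\<lambda>u. p u * u ^ (k - 1)) has_contour_integral 0) (circlepath 0 r)"
        by (rule Cauchy_theorem_disc_simple[of _ 0 1])
          (use r in \<open>auto intro!: holomorphic_intros hol\<close>)
      hence "((\<lambda>t. p (of_real r * e t) * (of_real r * e t) ^ (k - 1) * (2 * pi * \<i> * r * e t))
          has_integral 0) {0..1}"
        by (simp add: has_contour_integral circle circle')
      hence "((\<lambda>t. 1 / (2 * pi * \<i> * of_real r ^ k) *
            (p (of_real r * e t) * (of_real r * e t) ^ (k - 1) * (2 * pi * \<i> * r * e t)))
          has_integral 1 / (2 * pi * \<i> * of_real r ^ k) * 0) {0..1}"
        by (rule has_integral_mult_right)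
      moreover have "k = Suc (k - 1)" using k by simp
      then obtain l where "k = Suc l" by blast
      ultimately show ?thesis
        using r by (simp add: field_simps)
    qed
    have "((\<lambda>t. cnj (p (of_real r * e t) * e t ^ k)) has_integral 0) {0..1}"
      using B has_integral_cnj[of "\<lambda>t. p (of_real r * e t) * e t ^ k" 0 "{0..1}"]
      by (simp only: comp_def complex_cnj_zero)
    from has_integral_add[OF A[of k] this]
    have C: "((\<lambda>t. of_real (2 * Re (p (of_real r * e t))) * cnj (e t) ^ k)
        has_integral (taylor_coeff p k * of_real r ^ k)) {0..1}"
      by (simp add: complex_add_cnj flip: distrib_right)
    have "((\<lambda>t. 2 * Re (p (of_real r * e t))) has_integral 2 * Re (p 0)) {0..1}"
      using has_integral_Re[OF A[of 0]]
      by (intro has_integral_mult_right) (simp add: fps_expansion_def)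
    hence "cmod (taylor_coeff p k * of_real r ^ k) \<le> (2 * Re (p 0)) \<bullet> 1"
      using r by (intro has_integral_norm_bound_integral_component[OF C])
        (auto simp: norm_mult norm_power e_norm intro!: Re)
    thus ?thesis using r by (simp add: norm_mult norm_power)
  qed
  have "((\<lambda>r. cmod (taylor_coeff p k) * r ^ k) \<longlongrightarrow> cmod (taylor_coeff p k) * 1 ^ k) (at_left (1 :: real))"
    by (intro tendsto_intros)
  moreover have "eventually (\<lambda>r. cmod (taylor_coeff p k) * r ^ k \<le> 2 * Re (p 0)) (at_left (1 :: real))"
    using eventually_at_left_real[of 0 1] by (rule eventually_mono[OF _ bound]) auto
  ultimately have "cmod (taylor_coeff p k) * 1 ^ k \<le> 2 * Re (p 0)"
    by (rule tendsto_upperbound) simp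
  thus ?thesis by simp
qed

section \<open>Coefficients of starlike functions\<close>

text \<open>
  The function \<open>p = z F' / F\<close> extends holomorphically to the origin, where the zero of \<open>F\<close> is simple
  by the normalization. There is no other zero in the disk, because in HOL \<open>F z = 0\<close> would make the
  quotient \<open>0\<close>, against the hypothesis on its real part. The coefficient bound for \<open>p\<close> and
  comparison of coefficients in \<open>p F = z F'\<close> then carry the induction.
\<close>

lemma starlike_coeff_bound:
  assumes F: "F \<in> class_A"
    and Re: "\<And>z. z \<in> ball 0 1 \<Longrightarrow> z \<noteq> 0 \<Longrightarrow> Re (z * deriv F z / F z) > 0"
  shows "cmod (taylor_coeff F k) \<le> real k"
proof -
  have hol: "F holomorphic_on ball 0 1"
    using F by (simp add: class_A_def analytic_on_open)
  have F0: "F 0 = 0" "deriv F 0 = 1" and b0: "taylor_coeff F 0 = 0" and b1: "taylor_coeff F 1 = 1"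
    using F by (simp_all add: class_A_def fps_expansion_def)
  have nz: "F z \<noteq> 0" if "z \<in> ball 0 1" "z \<noteq> 0" for z
    using Re[OF that] by auto
  define G where "G z = (if z = 0 then 1 else F z / z)" for z
  define p where "p z = (if z = 0 then 1 else z * deriv F z / F z)" for z
  have "G holomorphic_on ball 0 1"
    by (rule pole_theorem_open_0[OF hol, of 0]) (auto simp: G_def F0)
  moreover have "G z \<noteq> 0" if "z \<in> ball 0 1" for z
    using nz[OF that] by (auto simp: G_def)
  ultimately have "(\<lambda>z. deriv F z / G z) holomorphic_on ball 0 1"
    by (intro holomorphic_intros hol) auto
  moreover have "p z = deriv F z / G z" for z
    by (auto simp: p_def G_def F0)
  hence "p = (\<lambda>z. deriv F z / G z)" by blast
  ultimately have hol_p: "p holomorphic_on ball 0 1" by simp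
  define P where "P = fps_expansion p 0"
  define B where "B = fps_expansion F 0"
  have P: "p has_fps_expansion P" and B: "F has_fps_expansion B"
    unfolding P_def B_def by (rule has_fps_expansion_fps_expansion[of "ball 0 1"]; use hol hol_p in simp)+
  have P0: "fps_nth P 0 = 1"
    by (simp add: P_def fps_expansion_def p_def)
  have P_bound: "cmod (fps_nth P i) \<le> 2" if "i > 0" for i
  proof -
    have "Re (p z) \<ge> 0" if "z \<in> ball 0 1" for z
      using Re[OF that] by (auto simp: p_def)
    moreover have "p 0 = 1" by (simp add: p_def)
    ultimately show ?thesis
      using caratheodory_coeff_bound[OF hol_p _ \<open>i > 0\<close>] by (simp add: P_def)
  qed
  have "(\<lambda>z. z * deriv F z) has_fps_expansion fps_X * fps_deriv B"
    by (intro fps_expansion_intros B)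
  moreover have "eventually (\<lambda>z. p z * F z = z * deriv F z) (nhds 0)"
    using eventually_nhds_in_open[of "ball 0 1" "0 :: complex"]
    by (rule eventually_mono) (use nz in \<open>auto simp: p_def F0\<close>)
  ultimately have "(\<lambda>z. p z * F z) has_fps_expansion fps_X * fps_deriv B"
    by (subst has_fps_expansion_cong[OF _ refl])
  moreover have "(\<lambda>z. p z * F z) has_fps_expansion P * B"
    by (intro fps_expansion_intros P B)
  ultimately have PB: "P * B = fps_X * fps_deriv B"
    by (rule fps_expansion_unique_complex[rotated])
  show ?thesis
  proof (induction k rule: less_induct)
    case (less k)
    consider "k = 0" | "k = 1" | "k \<ge> 2" by linarith
    thus ?case
    proof cases
      case 3
      \<comment> \<open>In the convolution the term of index \<open>k\<close> is \<open>fps_nth B k\<close> itself, since \<open>p 0 = 1\<close>; moving it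
        across leaves only earlier coefficients and the factor \<open>k - 1\<close>.\<close>
      have "of_nat k * fps_nth B k = fps_nth (P * B) k"
        using 3 by (subst PB, cases k) (simp_all add: fps_X_mult_nth)
      also have "\<dots> = (\<Sum>j=0..k. fps_nth B j * fps_nth P (k - j))"
        by (subst mult.commute) (rule fps_mult_nth)
      also have "{0..k} = insert k {..<k}" by auto
      also have "(\<Sum>j\<in>insert k {..<k}. fps_nth B j * fps_nth P (k - j)) =
          fps_nth B k + (\<Sum>j<k. fps_nth B j * fps_nth P (k - j))"
        by (simp add: P0)
      finally have rec: "of_nat (k - 1) * fps_nth B k = (\<Sum>j<k. fps_nth B j * fps_nth P (k - j))"
        using 3 by (simp add: of_nat_diff algebra_simps)
      have "real (k - 1) * cmod (fps_nth B k) = cmod (\<Sum>j<k. fps_nth B j * fps_nth P (k - j))"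
        by (simp add: norm_mult flip: rec)
      also have "\<dots> \<le> (\<Sum>j<k. real j * 2)"
        by (intro sum_norm_le) (auto simp: norm_mult B_def intro!: mult_mono less.IH P_bound)
      also have "\<dots> = real (k - 1) * real k"
      proof -
        have "(\<Sum>j<k. real j * 2) = (real k - 1) * real k"
          by (induction k) (simp_all add: algebra_simps)
        thus ?thesis using 3 by (simp add: of_nat_diff)
      qed
      finally show ?thesis
        using 3 by (simp add: B_def)
    qed (use b0 b1 in auto)
  qed
qed

section \<open>The operators as coefficient multipliers\<close>

definition L_mult :: "nat \<Rightarrow> real \<Rightarrow> nat \<Rightarrow> real" where
  "L_mult m \<sigma> k = (\<Prod>j<m. (\<sigma> + real k - 1 - real j) / (\<sigma> - real j))"

lemma L_mult_Suc:
  assumes "\<sigma> > real m"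
  shows "L_mult (Suc m) \<sigma> k = L_mult m \<sigma> k * ((\<sigma> - real m - 1) + real k) / (\<sigma> - real m)"
  using assms by (simp add: L_mult_def algebra_simps)

lemma L_mult_1:
  assumes "\<sigma> > real m - 1"
  shows "L_mult m \<sigma> 1 = 1"
  unfolding L_mult_def using assms by (intro prod.neutral) auto

lemma coeff_factor_L_mult:
  assumes "\<sigma> \<ge> real n" "k \<ge> 2"
  shows "L_mult n \<sigma> k * coeff_factor n \<sigma> k = 1"
proof -
  have "L_mult n \<sigma> k * coeff_factor n \<sigma> k =
      (\<Prod>j<n. (\<sigma> + real k - 1 - real j) / (\<sigma> - real j) * ((\<sigma> - real j) / (\<sigma> + real k - 1 - real j)))"
    unfolding L_mult_def coeff_factor_eq_prod[OF assms] by (simp only: prod.distrib)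
  also have "\<dots> = 1"
    using assms by (intro prod.neutral) auto
  finally show ?thesis .
qed

lemma coeff_factor_bounds:
  assumes "\<sigma> \<ge> real n" "k \<ge> 2"
  shows "0 < coeff_factor n \<sigma> k" "coeff_factor n \<sigma> k \<le> 1"
proof -
  show "0 < coeff_factor n \<sigma> k"
    unfolding coeff_factor_eq_prod[OF assms] using assms by (intro prod_pos) auto
  show "coeff_factor n \<sigma> k \<le> 1"
    unfolding coeff_factor_eq_prod[OF assms] using assms by (intro prod_le_1) auto
qed

lemma deriv_power_series_sums:
  fixes F :: "complex \<Rightarrow> complex"
  assumes sums: "\<And>z. z \<in> ball 0 1 \<Longrightarrow> (\<lambda>k. b k * z ^ k) sums F z"
    and z: "z \<in> ball 0 1"
  shows "(\<lambda>k. of_nat k * b k * z ^ k) sums (z * deriv F z)"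
proof -
  have "F holomorphic_on ball 0 1"
    using power_series_holomorphic[of 0 1 b F] sums by simp
  hence "(F has_field_derivative deriv F z) (at z)"
    using z by (auto intro: holomorphic_derivI)
  hence "(\<lambda>k. diffs b k * z ^ k) sums deriv F z"
    using termdiffs_sums_strong[of 1 b F] sums z by simp
  hence "(\<lambda>k. z * (diffs b k * z ^ k)) sums (z * deriv F z)"
    by (rule sums_mult)
  hence "(\<lambda>k. of_nat (Suc k) * b (Suc k) * z ^ Suc k) sums (z * deriv F z)"
    by (simp add: diffs_def mult_ac)
  thus ?thesis by (subst (asm) sums_Suc_iff) simp
qed

lemma L_op_eq_sum:
  assumes f: "f \<in> class_A" and \<sigma>: "\<sigma> > real m - 1"
    and sums: "(\<lambda>k. of_real (L_mult m \<sigma> k) * taylor_coeff f k * z ^ k) sums s"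
  shows "L_op m \<sigma> f z = s"
proof -
  let ?b = "\<lambda>k. of_real (L_mult m \<sigma> k) * taylor_coeff f k * z ^ k"
  have "(\<Sum>k<2. ?b k) = z"
    using f L_mult_1[OF \<sigma>] by (simp add: class_A_def numeral_2_eq_2)
  hence "(\<lambda>k. ?b (k + 2)) sums (s - z)"
    using sums sums_iff_shift[of ?b 2 "s - z"] by simp
  hence "(\<Sum>k. ?b (k + 2)) = s - z" by (rule sums_unique[symmetric])
  moreover have "L_op m \<sigma> f z = z + (\<Sum>k. ?b (k + 2))"
    by (simp only: L_op_def L_mult_def Let_def)
  ultimately show ?thesis by simp
qed

text \<open>
  The multipliers of \<open>L_op (Suc m)\<close> combine those of \<open>L_op m\<close> with the factor \<open>k\<close> that \<open>z d/dz\<close>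
  produces. This carries convergence on the whole disk from one operator to the next, and gives the
  differential relation between them.
\<close>

lemma L_mult_Suc_sums:
  fixes F :: "complex \<Rightarrow> complex"
  assumes sums: "\<And>w. w \<in> ball 0 1 \<Longrightarrow> (\<lambda>k. of_real (L_mult m \<sigma> k) * a k * w ^ k) sums F w"
    and \<sigma>: "\<sigma> > real m" and z: "z \<in> ball 0 1"
  shows "(\<lambda>k. of_real (L_mult (Suc m) \<sigma> k) * a k * z ^ k) sums
    ((of_real (\<sigma> - real m - 1) * F z + z * deriv F z) / of_real (\<sigma> - real m))"
proof -
  let ?b = "\<lambda>k. of_real (L_mult m \<sigma> k) * a k"
  have "(\<lambda>k. (of_real (\<sigma> - real m - 1) * (?b k * z ^ k) + of_nat k * ?b k * z ^ k) / of_real (\<sigma> - real m)) sums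
      ((of_real (\<sigma> - real m - 1) * F z + z * deriv F z) / of_real (\<sigma> - real m))"
    by (intro sums_divide sums_add sums_mult sums deriv_power_series_sums[of ?b, OF sums] z)
  moreover have "(of_real (\<sigma> - real m - 1) * (?b k * z ^ k) + of_nat k * ?b k * z ^ k) / of_real (\<sigma> - real m) =
      of_real (L_mult (Suc m) \<sigma> k) * a k * z ^ k" for k
    by (simp add: L_mult_Suc[OF \<sigma>] algebra_simps add_divide_distrib diff_divide_distrib)
  ultimately show ?thesis by simp
qed

lemma L_op_sums:
  assumes f: "f \<in> class_A" and \<sigma>: "\<sigma> > real m - 1" and z: "z \<in> ball 0 1"
  shows "(\<lambda>k. of_real (L_mult m \<sigma> k) * taylor_coeff f k * z ^ k) sums L_op m \<sigma> f z"
  using \<sigma> z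
proof (induction m arbitrary: z)
  case 0
  have "(\<lambda>k. taylor_coeff f k * z ^ k) sums f z"
    using f 0 holomorphic_power_series[of f 0 1 z]
    by (simp add: class_A_def analytic_on_open fps_expansion_def)
  hence "(\<lambda>k. of_real (L_mult 0 \<sigma> k) * taylor_coeff f k * z ^ k) sums f z"
    by (simp add: L_mult_def)
  with L_op_eq_sum[OF f _ this] 0 show ?case by simp
next
  case (Suc m)
  have \<sigma>: "\<sigma> > real m" using Suc.prems by simp
  note sums = L_mult_Suc_sums[OF Suc.IH \<sigma> Suc.prems(2)]
  show ?case
    using L_op_eq_sum[OF f _ sums] sums \<sigma> by simp
qed

lemma L_op_Suc:
  assumes f: "f \<in> class_A" and \<sigma>: "\<sigma> > real m" and z: "z \<in> ball 0 1"
  shows "L_op (Suc m) \<sigma> f z =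
    (of_real (\<sigma> - real m - 1) * L_op m \<sigma> f z + z * deriv (L_op m \<sigma> f) z) / of_real (\<sigma> - real m)"
proof (rule L_op_eq_sum[OF f])
  show "(\<lambda>k. of_real (L_mult (Suc m) \<sigma> k) * taylor_coeff f k * z ^ k) sums
    ((of_real (\<sigma> - real m - 1) * L_op m \<sigma> f z + z * deriv (L_op m \<sigma> f) z) / of_real (\<sigma> - real m))"
    by (rule L_mult_Suc_sums[OF L_op_sums[OF f]]) (use \<sigma> z in auto)
qed (use \<sigma> in simp)

lemma taylor_coeff_L_op:
  assumes f: "f \<in> class_A" and \<sigma>: "\<sigma> > real m - 1"
  shows "taylor_coeff (L_op m \<sigma> f) k = of_real (L_mult m \<sigma> k) * taylor_coeff f k"
proof -
  have "eventually (\<lambda>z. (\<lambda>k. fps_nth (Abs_fps (\<lambda>k. of_real (L_mult m \<sigma> k) * taylor_coeff f k)) k * z ^ k)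
      sums L_op m \<sigma> f z) (nhds 0)"
    using eventually_nhds_in_open[of "ball 0 1" "0 :: complex"] L_op_sums[OF f \<sigma>]
    by (auto elim!: eventually_mono)
  hence "fps_expansion (L_op m \<sigma> f) 0 = Abs_fps (\<lambda>k. of_real (L_mult m \<sigma> k) * taylor_coeff f k)"
    by (intro fps_expansion_eqI has_fps_expansionI)
  thus ?thesis by simp
qed

lemma L_op_in_class_A:
  assumes f: "f \<in> class_A" and \<sigma>: "\<sigma> > real m - 1"
  shows "L_op m \<sigma> f \<in> class_A"
proof -
  have "L_op m \<sigma> f holomorphic_on ball 0 1"
    using power_series_holomorphic[of 0 1 "\<lambda>k. of_real (L_mult m \<sigma> k) * taylor_coeff f k"]
      L_op_sums[OF f \<sigma>] by simp
  thus ?thesis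
    using f by (simp add: class_A_def analytic_on_open taylor_coeff_L_op[OF f \<sigma>] L_mult_1[OF \<sigma>, simplified])
qed

text \<open>
  By \<open>L_op_Suc\<close> the quotient in the definition of the class is
  \<open>((\<sigma> - n - 1) + z F' / F) / (\<sigma> - n)\<close> for \<open>F = L_op n \<sigma> f\<close>. At a zero of \<open>F\<close> off the origin both
  quotients take the HOL value \<open>0\<close>, and both inequalities fail, the first because
  \<open>\<sigma> \<ge> n + 1\<close>.
\<close>

lemma class_S_iff_starlike:
  assumes \<sigma>: "\<sigma> \<ge> real n + 1"
  shows "f \<in> class_S n \<sigma> \<longleftrightarrow> f \<in> class_A \<and>
    (\<forall>z\<in>ball 0 1 - {0}. Re (z * deriv (L_op n \<sigma> f) z / L_op n \<sigma> f z) > 0)"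
proof -
  have iff: "Re (L_op (n + 1) \<sigma> f z / L_op n \<sigma> f z) > (\<sigma> - (real n + 1)) / (\<sigma> - real n) \<longleftrightarrow>
      Re (z * deriv (L_op n \<sigma> f) z / L_op n \<sigma> f z) > 0"
    if f: "f \<in> class_A" and z: "z \<in> ball 0 1" for z
  proof (cases "L_op n \<sigma> f z = 0")
    case True
    have "(\<sigma> - (real n + 1)) / (\<sigma> - real n) \<ge> 0"
      using \<sigma> by simp
    with True show ?thesis by simp
  next
    case False
    define q where "q = z * deriv (L_op n \<sigma> f) z / L_op n \<sigma> f z"
    have "L_op (n + 1) \<sigma> f z / L_op n \<sigma> f z =
        (of_real (\<sigma> - real n - 1) + q) / of_real (\<sigma> - real n)"
      using L_op_Suc[OF f _ z, of n \<sigma>] \<sigma> False by (simp add: q_def field_simps)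
    hence "Re (L_op (n + 1) \<sigma> f z / L_op n \<sigma> f z) = (\<sigma> - (real n + 1) + Re q) / (\<sigma> - real n)"
      by (simp only: Re_divide_of_real plus_complex.sel Re_complex_of_real diff_diff_eq)
    thus ?thesis
      using \<sigma> unfolding q_def[symmetric] by (simp add: divide_less_cancel)
  qed
  have "(\<sigma> - (real n + 1)) / (\<sigma> - real n) < 1"
    using \<sigma> by simp
  thus ?thesis
    using iff by (auto simp: class_S_def)
qed

section \<open>The extremal function\<close>

lemma koebe_sums:
  fixes z :: complex
  assumes "z \<in> ball 0 1"
  shows "(\<lambda>k. of_nat k * z ^ k) sums (z / (1 - z)\<^sup>2)"
proof -
  have "(\<lambda>k. z * (of_nat (Suc k) * z ^ k)) sums (z * (1 / (1 - z)\<^sup>2))"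
    by (intro sums_mult geometric_deriv_sums) (use assms in simp)
  hence "(\<lambda>k. of_nat (Suc k) * z ^ Suc k) sums (z / (1 - z)\<^sup>2)"
    by (simp add: mult_ac)
  thus ?thesis by (subst (asm) sums_Suc_iff) simp
qed

lemma koebe_starlike:
  fixes z :: complex
  assumes z: "z \<in> ball 0 1" "z \<noteq> 0"
  shows "Re (z * deriv (\<lambda>z. z / (1 - z)\<^sup>2) z / (z / (1 - z)\<^sup>2)) > 0"
proof -
  have ne: "1 - z \<noteq> 0" using z by auto
  have "((\<lambda>z. z / (1 - z)\<^sup>2) has_field_derivative
      ((1 - z)\<^sup>2 + 2 * z * (1 - z)) / ((1 - z)\<^sup>2 * (1 - z)\<^sup>2)) (at z)"
    using ne by (auto intro!: derivative_eq_intros simp: algebra_simps)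
  also have "(1 - z)\<^sup>2 + 2 * z * (1 - z) = (1 + z) * (1 - z)"
    by (simp add: power2_eq_square algebra_simps)
  finally have "deriv (\<lambda>z. z / (1 - z)\<^sup>2) z = (1 + z) * (1 - z) / ((1 - z)\<^sup>2 * (1 - z)\<^sup>2)"
    by (rule DERIV_imp_deriv)
  hence "z * deriv (\<lambda>z. z / (1 - z)\<^sup>2) z / (z / (1 - z)\<^sup>2) = (1 + z) / (1 - z)"
    using z(2) ne by (simp add: power2_eq_square)
  also have "Re \<dots> = (1 - (cmod z)\<^sup>2) / (cmod (1 - z))\<^sup>2"
    unfolding cmod_power2 by (simp add: Re_divide algebra_simps power2_eq_square)
  also have "\<dots> > 0"
    using z ne by (simp add: power_less_one_iff abs_square_less_1)
  finally show ?thesis .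
qed

text \<open>
  The factors \<open>coeff_factor n \<sigma> k\<close> are at most \<open>1\<close>, so the Koebe series dominates.
\<close>

lemma extremal_fun_sums:
  assumes \<sigma>: "\<sigma> \<ge> real n" and z: "z \<in> ball 0 1"
  shows "(\<lambda>k. of_real (coeff_factor n \<sigma> (k + 2)) * of_nat (k + 2) * z ^ (k + 2)) sums
    (extremal_fun n \<sigma> z - z)"
proof -
  let ?a = "\<lambda>k. of_real (coeff_factor n \<sigma> (k + 2)) * of_nat (k + 2) * z ^ (k + 2)"
  have "summable (\<lambda>k. of_nat k * of_real (cmod z) ^ k :: complex)"
    using koebe_sums[of "of_real (cmod z)"] z by (auto simp: sums_iff)
  hence "summable (\<lambda>k. complex_of_real (real k * cmod z ^ k))"
    by simp
  hence "summable (\<lambda>k. real k * cmod z ^ k)"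
    by (simp only: summable_of_real_iff)
  hence "summable (\<lambda>k. real (k + 2) * cmod z ^ (k + 2))"
    by (rule summable_ignore_initial_segment)
  moreover have "cmod (?a k) \<le> real (k + 2) * cmod z ^ (k + 2)" for k
  proof -
    have "\<bar>coeff_factor n \<sigma> (k + 2)\<bar> \<le> 1"
      using coeff_factor_bounds[OF \<sigma>, of "k + 2"] by simp
    from mult_right_mono[OF this, of "real (k + 2) * cmod z ^ (k + 2)"] show ?thesis
      by (simp only: norm_mult norm_power norm_of_real norm_of_nat mult.assoc mult_1_left) simp
  qed
  ultimately have "summable ?a"
    by (rule summable_comparison_test'[where N = 0])
  hence "?a sums suminf ?a"
    by (rule summable_sums)
  thus ?thesis
    by (simp only: extremal_fun_def Let_def add_diff_cancel_left')
qed

lemma extremal_fun_in_class_A: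
  assumes "\<sigma> \<ge> real n"
  shows "extremal_fun n \<sigma> \<in> class_A"
  unfolding class_A_iff_power_series
  by (rule exI[of _ "\<lambda>k. of_real (coeff_factor n \<sigma> k) * of_nat k"]) (use extremal_fun_sums[OF assms] in blast)

lemma taylor_coeff_extremal_fun:
  assumes "\<sigma> \<ge> real n" "k \<ge> 2"
  shows "taylor_coeff (extremal_fun n \<sigma>) k = of_real (coeff_factor n \<sigma> k) * of_nat k"
  using normalized_power_series(2)[OF extremal_fun_sums[OF assms(1)], of k] assms(2) by simp

lemma L_op_extremal_fun:
  assumes \<sigma>: "\<sigma> \<ge> real n" and z: "z \<in> ball 0 1"
  shows "L_op n \<sigma> (extremal_fun n \<sigma>) z = z / (1 - z)\<^sup>2"
proof (rule L_op_eq_sum)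
  show A: "extremal_fun n \<sigma> \<in> class_A" by (rule extremal_fun_in_class_A[OF \<sigma>])
  show \<sigma>': "\<sigma> > real n - 1" using \<sigma> by simp
  have "of_real (L_mult n \<sigma> k) * taylor_coeff (extremal_fun n \<sigma>) k = of_nat k" for k
  proof -
    consider "k = 0" | "k = 1" | "k \<ge> 2" by linarith
    thus ?thesis
    proof cases
      case 3
      have "of_real (L_mult n \<sigma> k) * taylor_coeff (extremal_fun n \<sigma>) k =
          of_real (L_mult n \<sigma> k * coeff_factor n \<sigma> k) * of_nat k"
        by (simp add: taylor_coeff_extremal_fun[OF \<sigma> 3])
      thus ?thesis by (simp add: coeff_factor_L_mult[OF \<sigma> 3])
    qed (use A L_mult_1[OF \<sigma>'] in \<open>auto simp: class_A_def\<close>)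
  qed
  thus "(\<lambda>k. of_real (L_mult n \<sigma> k) * taylor_coeff (extremal_fun n \<sigma>) k * z ^ k) sums (z / (1 - z)\<^sup>2)"
    using koebe_sums[OF z] by simp
qed

lemma extremal_fun_in_class_S:
  assumes \<sigma>: "\<sigma> \<ge> real n + 1"
  shows "extremal_fun n \<sigma> \<in> class_S n \<sigma>"
proof -
  have \<sigma>': "\<sigma> \<ge> real n" using \<sigma> by simp
  note eq = L_op_extremal_fun[OF \<sigma>']
  have "deriv (L_op n \<sigma> (extremal_fun n \<sigma>)) z = deriv (\<lambda>z. z / (1 - z)\<^sup>2) z" if "z \<in> ball 0 1" for z
    by (intro deriv_cong_ev refl eventually_mono[OF eventually_nhds_in_open[OF open_ball that]] eq)
  thus ?thesis
    using koebe_starlike eq extremal_fun_in_class_A[OF \<sigma>'] by (simp add: class_S_iff_starlike[OF \<sigma>])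
qed

section \<open>The coefficient bounds\<close>

theorem theorem6:
  fixes n :: nat and \<sigma> :: real
  assumes "\<sigma> \<ge> real n + 1"
  shows "(\<forall>f\<in>class_S n \<sigma>. \<forall>k\<ge>2. cmod (taylor_coeff f k) \<le> coeff_factor n \<sigma> k * real k) \<and>
    extremal_fun n \<sigma> \<in> class_S n \<sigma> \<and>
    (\<forall>k\<ge>2. cmod (taylor_coeff (extremal_fun n \<sigma>) k) = coeff_factor n \<sigma> k * real k)"
proof (intro conjI ballI allI impI)
  have \<sigma>: "\<sigma> \<ge> real n" "\<sigma> > real n - 1" using assms by simp_all
  note pos = coeff_factor_bounds(1)[OF \<sigma>(1)]
  show "extremal_fun n \<sigma> \<in> class_S n \<sigma>"
    by (rule extremal_fun_in_class_S[OF assms])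
  show "cmod (taylor_coeff (extremal_fun n \<sigma>) k) = coeff_factor n \<sigma> k * real k" if "k \<ge> 2" for k
    using pos[OF that] by (simp add: taylor_coeff_extremal_fun[OF \<sigma>(1) that] norm_mult)
  show "cmod (taylor_coeff f k) \<le> coeff_factor n \<sigma> k * real k" if f: "f \<in> class_S n \<sigma>" and k: "k \<ge> 2" for f k
  proof -
    have A: "f \<in> class_A" using f by (simp add: class_S_def)
    have "taylor_coeff f k = of_real (coeff_factor n \<sigma> k * L_mult n \<sigma> k) * taylor_coeff f k"
      using coeff_factor_L_mult[OF \<sigma>(1) k] by (simp only: mult.commute) simp
    also have "\<dots> = of_real (coeff_factor n \<sigma> k) * taylor_coeff (L_op n \<sigma> f) k"
      by (simp add: taylor_coeff_L_op[OF A \<sigma>(2)])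
    finally have "cmod (taylor_coeff f k) = coeff_factor n \<sigma> k * cmod (taylor_coeff (L_op n \<sigma> f) k)"
      using pos[OF k] by (metis abs_of_pos norm_mult norm_of_real)
    moreover have "cmod (taylor_coeff (L_op n \<sigma> f) k) \<le> real k"
      using f by (intro starlike_coeff_bound L_op_in_class_A A \<sigma>) (auto simp: class_S_iff_starlike[OF assms])
    ultimately show ?thesis
      using pos[OF k] by (simp add: mult_left_mono)
  qed
qed

end
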